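(* Being bipartite (the graph property consisting of all bipartite graphs on the vertex set $\mathbb{N}$) is $\infty$-elusive.
   Context: Let $[\mathbb{N}]^2=\{\{n,k\}: n,k\in\mathbb{N},\ n\neq k\}$. A graph on $\mathbb{N}$ is a subset $G\subseteq[\mathbb{N}]^2$, so the set of graphs is $2^{[\mathbb{N}]^2}$. A graph property is an isomorphism-invariant subset $\mathcal{S}\subseteq 2^{[\mathbb{N}]^2}$. The game $G(\mathcal{S})$. Two players, Seeker and Hider, colour the edges of the complete graph on $\mathbb{N}$ with red, white, green. Initially all edges are white. In each turn Seeker picks a white edge and Hider recolours it green or red. The game terminates after infinitely many (that is, $\omega$ many) turns. Let $R_\infty,W_\infty,G_\infty$ be the sets of red, white and green edges at the end, and let $\mathcal{P}_\infty=\{G\subseteq[\mathbb{N}]^2: G_\infty\subseteq G\subseteq G_\infty\cup W_\infty\}$. Seeker wins if and only if $W_\infty\neq\emptyset$ and either $\mathcal{P}_\infty\subseteq\mathcal{S}$ or $\mathcal{P}_\infty\subseteq 2^{[\mathbb{N}]^2}\setminus\mathcal{S}$; otherwise Hider wins. The property $\mathcal{S}$ is $\infty$-elusive if Seeker does not have a winning strategy in $G(\mathcal{S})$. *)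

theory Defs
  imports "HOL-Library.Ramsey"
begin

abbreviation edges :: "nat set set" where
  "edges \<equiv> nsets UNIV 2"

definition graph_property :: "nat set set set \<Rightarrow> bool" where
  "graph_property S \<longleftrightarrow>
     S \<subseteq> Pow edges \<and> (\<forall>G \<in> S. \<forall>f :: nat \<Rightarrow> nat. bij f \<longrightarrow> (\<lambda>e. f ` e) ` G \<in> S)"

text \<open>
  The game. White is the absence of an answer: an edge is white as long as Seeker
  has not asked for it. A position is the finite list of the turns played so far, oldest
  turn first; a turn is the edge picked by Seeker with the colour given by Hider.
\<close>

datatype answer = Green | Red

type_synonym turn = "nat set \<times> answer"

definition white :: "turn list \<Rightarrow> nat set set" where
  "white h = edges - fst ` set h"

definition position :: "turn list \<Rightarrow> bool" where
  "position h \<longleftrightarrow> (\<forall>i < length h. fst (h ! i) \<in> white (take i h))"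

definition seeker_strategy :: "(turn list \<Rightarrow> nat set) \<Rightarrow> bool" where
  "seeker_strategy \<sigma> \<longleftrightarrow> (\<forall>h. position h \<longrightarrow> \<sigma> h \<in> white h)"

text \<open>
  When the strategy satisfies \<^const>\<open>seeker_strategy\<close>, every initial segment of a
  play following it is a \<^const>\<open>position\<close>, so the rules of the game are respected.
\<close>

definition follows :: "(nat \<Rightarrow> turn) \<Rightarrow> (turn list \<Rightarrow> nat set) \<Rightarrow> bool" where
  "follows p \<sigma> \<longleftrightarrow> (\<forall>n. fst (p n) = \<sigma> (map p [0..<n]))"

definition final_green :: "(nat \<Rightarrow> turn) \<Rightarrow> nat set set" where
  "final_green p = {e. (e, Green) \<in> range p}"

definition final_red :: "(nat \<Rightarrow> turn) \<Rightarrow> nat set set" where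
  "final_red p = {e. (e, Red) \<in> range p}"

definition final_white :: "(nat \<Rightarrow> turn) \<Rightarrow> nat set set" where
  "final_white p = edges - (final_green p \<union> final_red p)"

definition final_graphs :: "(nat \<Rightarrow> turn) \<Rightarrow> nat set set set" where
  "final_graphs p =
     {G. G \<subseteq> edges \<and> final_green p \<subseteq> G \<and> G \<subseteq> final_green p \<union> final_white p}"

definition seeker_wins :: "nat set set set \<Rightarrow> (nat \<Rightarrow> turn) \<Rightarrow> bool" where
  "seeker_wins S p \<longleftrightarrow>
     final_white p \<noteq> {} \<and> (final_graphs p \<subseteq> S \<or> final_graphs p \<subseteq> Pow edges - S)"

definition winning_strategy :: "nat set set set \<Rightarrow> (turn list \<Rightarrow> nat set) \<Rightarrow> bool" where
  "winning_strategy S \<sigma> \<longleftrightarrow>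
     seeker_strategy \<sigma> \<and> (\<forall>p. follows p \<sigma> \<longrightarrow> seeker_wins S p)"

definition infty_elusive :: "nat set set set \<Rightarrow> bool" where
  "infty_elusive S \<longleftrightarrow> (\<nexists>\<sigma>. winning_strategy S \<sigma>)"

definition bipartite :: "nat set set \<Rightarrow> bool" where
  "bipartite G \<longleftrightarrow>
     (\<exists>A B. A \<union> B = UNIV \<and> A \<inter> B = {} \<and> (\<forall>e \<in> G. \<exists>a \<in> A. \<exists>b \<in> B. e = {a, b}))"

definition bipartite_graphs :: "nat set set set" where
  "bipartite_graphs = {G. G \<subseteq> edges \<and> bipartite G}"

lemma graph_property_bipartite_graphs: "graph_property bipartite_graphs"
proof -
  have "(\<lambda>e. f ` e) ` G \<in> bipartite_graphs"
    if G: "G \<in> bipartite_graphs" and f: "bij f" for G and f :: "nat \<Rightarrow> nat"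
  proof -
    obtain A B where AB: "A \<union> B = UNIV" "A \<inter> B = {}"
      and e: "\<forall>e \<in> G. \<exists>a \<in> A. \<exists>b \<in> B. e = {a, b}"
      using G unfolding bipartite_graphs_def bipartite_def by blast
    have inj: "inj f" and surj: "surj f" using f by (auto simp: bij_def)
    have "(\<lambda>e. f ` e) ` G \<subseteq> edges"
      using G inj by (auto simp: bipartite_graphs_def nsets_def card_image inj_on_subset)
    moreover have "f ` A \<union> f ` B = UNIV"
      using AB surj by (metis image_Un)
    moreover have "f ` A \<inter> f ` B = {}"
      using AB inj by (metis image_Int image_empty)
    moreover have "\<forall>e \<in> (\<lambda>e. f ` e) ` G. \<exists>a \<in> f ` A. \<exists>b \<in> f ` B. e = {a, b}"
      using e by fastforce
    ultimately show ?thesis unfolding bipartite_graphs_def bipartite_def by blast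
  qed
  then show ?thesis unfolding graph_property_def by (auto simp: bipartite_graphs_def)
qed

end

theory Submission
  imports Defs
begin

text \<open>
  Hider wants the green graph to stay bipartite while green and white together are not
  bipartite, for as long as some edge is white. He plays in stages. A stage concerns a finite
  vertex set \<open>V\<close>; edges not inside \<open>V\<close> are answered red meanwhile, and the stage ends when
  no edge inside \<open>V\<close> is white. If every stage ends, no edge is white at the end of the play and
  Seeker has lost. Otherwise the last stage leaves white edges inside a finite \<open>V\<close>, so finitely
  many turns decide the outcome, and it suffices that every position within a stage is good
  for Hider.

  The idea within a stage is to build green connected pieces, each with its forced
  bipartition \<open>(A, B)\<close>, a \<open>block\<close>, in such a way that a white edge inside a block joins
  two vertices of the same side and hence closes an odd cycle. An edge between two blocks can be
  answered green, merging them, once it is the last white edge among those that the merged block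
  would put across its bipartition. Before that, red is harmless: as long as each of the two ways
  of aligning the blocks is contradicted by a white edge (\<open>linked\<close>), green and white
  together are not bipartite. With two linked blocks this leads to a single spanning block,
  and from then on every answer is red.

  A new stage has to absorb a further vertex \<open>u\<close>, and Seeker may have had all edges
  from \<open>u\<close> to the old block coloured red already, so that these two are not linked. Two
  untouched vertices \<open>x\<close> and \<open>y\<close> repair this. All their edges are white, and whichever
  piece first absorbs one of them, enough links remain for the game to go on. The
  finitely many configurations that occur are the introduction rules of \<open>secure\<close>;
  \<open>secure_step\<close> says that Hider can stay among them, \<open>secure_proper\<close> and
  \<open>secure_not_proper\<close> that they are good for him, and \<open>secure_extend\<close> that the next
  stage starts among them.
\<close>

section \<open>Proper colourings and rigid blocks\<close>

definition proper :: "(nat \<Rightarrow> bool) \<Rightarrow> nat set set \<Rightarrow> bool" where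
  "proper c g \<longleftrightarrow> (\<forall>a b. {a, b} \<in> g \<longrightarrow> c a \<noteq> c b)"

lemma proper_mono: "proper c g \<Longrightarrow> g' \<subseteq> g \<Longrightarrow> proper c g'"
  unfolding proper_def by blast

lemma bipartite_iff_proper:
  assumes "g \<subseteq> edges"
  shows "bipartite g \<longleftrightarrow> (\<exists>c. proper c g)"
proof
  assume "bipartite g"
  then obtain A B where "A \<union> B = UNIV" "A \<inter> B = {}"
    and e: "\<forall>e \<in> g. \<exists>a \<in> A. \<exists>b \<in> B. e = {a, b}"
    unfolding bipartite_def by blast
  then have "proper (\<lambda>v. v \<in> A) g"
    unfolding proper_def by (metis disjoint_iff doubleton_eq_iff)
  then show "\<exists>c. proper c g" by blast
next
  assume "\<exists>c. proper c g"
  then obtain c where c: "proper c g" by blast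
  have "\<exists>a \<in> {v. c v}. \<exists>b \<in> {v. \<not> c v}. e = {a, b}" if e: "e \<in> g" for e
  proof -
    obtain a b where ab: "e = {a, b}"
      using e assms by (auto simp: nsets_def card_2_iff)
    then have "c a \<noteq> c b" using c e unfolding proper_def by blast
    then show ?thesis using ab by (auto simp: insert_commute)
  qed
  moreover have "{v. c v} \<union> {v. \<not> c v} = UNIV" "{v. c v} \<inter> {v. \<not> c v} = {}" by auto
  ultimately show "bipartite g" unfolding bipartite_def by blast
qed

definition cross :: "nat set \<Rightarrow> nat set \<Rightarrow> nat set set" where
  "cross A B = {{a, b} | a b. a \<in> A \<and> b \<in> B}"

lemma crossI: "a \<in> A \<Longrightarrow> b \<in> B \<Longrightarrow> {a, b} \<in> cross A B"
  unfolding cross_def by blast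

lemma crossD: "e \<in> cross A B \<Longrightarrow> e \<subseteq> A \<union> B \<and> e \<inter> A \<noteq> {} \<and> e \<inter> B \<noteq> {}"
  unfolding cross_def by blast

lemma cross_commute: "cross A B = cross B A"
  unfolding cross_def by (auto simp: insert_commute)

lemma cross_empty [simp]: "cross {} B = {}" "cross A {} = {}"
  unfolding cross_def by auto

lemma cross_Un:
  "cross (A \<union> A') B = cross A B \<union> cross A' B"
  "cross A (B \<union> B') = cross A B \<union> cross A B'"
  unfolding cross_def by blast+

lemma cross_mono: "A \<subseteq> A' \<Longrightarrow> B \<subseteq> B' \<Longrightarrow> cross A B \<subseteq> cross A' B'"
  unfolding cross_def by blast

lemma cross_singletons [simp]: "cross {a} {b} = {{a, b}}"
  unfolding cross_def by blast

lemma proper_if_subset_cross: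
  assumes "A \<inter> B = {}" "g \<subseteq> cross A B"
  shows "\<exists>c. proper c g"
proof -
  have "proper (\<lambda>v. v \<in> A) (cross A B)"
    using assms(1) unfolding proper_def cross_def by (auto simp: doubleton_eq_iff)
  then have "proper (\<lambda>v. v \<in> A) g" using assms(2) by (rule proper_mono)
  then show ?thesis by (rule exI[where x = "\<lambda>v. v \<in> A"])
qed

text \<open>
  This is how green connectedness enters: when \<open>g\<close> is a connected bipartite graph with sides
  \<open>A\<close> and \<open>B\<close>, its only proper colourings are the two that separate the sides. Speaking
  of colourings instead of paths makes merging two blocks a matter of comparing two truth values.
\<close>
definition rigid :: "nat set set \<Rightarrow> nat set \<Rightarrow> nat set \<Rightarrow> bool" where
  "rigid g A B \<longleftrightarrow>
     (\<forall>c. proper c g \<longrightarrow> (\<exists>s. (\<forall>a \<in> A. c a = s) \<and> (\<forall>b \<in> B. c b = (\<not> s))))"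

text \<open>
  Here and below \<open>g\<close> stands for the green and \<open>w\<close> for the white edges. The last conjunct
  is what makes a white edge inside a block useful to Hider: it joins two vertices of one side.
\<close>
definition block :: "nat set set \<Rightarrow> nat set set \<Rightarrow> nat set \<Rightarrow> nat set \<Rightarrow> bool" where
  "block g w A B \<longleftrightarrow> A \<inter> B = {} \<and> rigid g A B \<and> w \<inter> cross A B = {}"

lemma rigid_swap:
  assumes "rigid g A B"
  shows "rigid g B A"
  unfolding rigid_def
proof (intro allI impI)
  fix c assume c: "proper c g"
  obtain s where "\<forall>a \<in> A. c a = s" "\<forall>b \<in> B. c b = (\<not> s)"
    using assms[unfolded rigid_def, rule_format, OF c] by (elim exE conjE)
  then show "\<exists>s. (\<forall>b \<in> B. c b = s) \<and> (\<forall>a \<in> A. c a = (\<not> s))"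
    by (intro exI[of _ "\<not> s"]) simp
qed

lemma block_swap: "block g w A B \<Longrightarrow> block g w B A"
  unfolding block_def using rigid_swap[of g A B] cross_commute[of A B] by blast

lemma block_singleton: "block g w {v} {}"
  unfolding block_def rigid_def by auto

lemma rigid_colours:
  assumes "rigid g A B" "proper c (g \<union> w)"
  shows "\<exists>s. (\<forall>a \<in> A. c a = s) \<and> (\<forall>b \<in> B. c b = (\<not> s))"
proof -
  have c: "proper c g" using assms(2) by (rule proper_mono) simp
  show ?thesis
    using assms(1)[unfolded rigid_def, rule_format, OF c] .
qed

lemma block_mono:
  assumes "block g w A B" "g \<subseteq> g'" "w' \<subseteq> w"
  shows "block g' w' A B"
proof -
  have "rigid g' A B" if "rigid g A B"
    unfolding rigid_def
  proof (intro allI impI)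
    fix c assume "proper c g'"
    then have "proper c g" using assms(2) by (rule proper_mono)
    then show "\<exists>s. (\<forall>a \<in> A. c a = s) \<and> (\<forall>b \<in> B. c b = (\<not> s))"
      by (rule that[unfolded rigid_def, rule_format])
  qed
  then show ?thesis using assms(1,3) unfolding block_def by blast
qed

text \<open>
  A green edge between \<open>A\<close> and \<open>A'\<close>, or between \<open>B\<close> and \<open>B'\<close>, forces the two
  bipartitions to be aligned crosswise. The only edges that the merged block newly puts across its
  bipartition are those in \<open>cross A A'\<close> and \<open>cross B B'\<close>, so none of them may remain white.
\<close>
lemma block_merge:
  assumes 1: "block g w A B" and 2: "block g w A' B'"
    and disj: "(A \<union> B) \<inter> (A' \<union> B') = {}"
    and e: "e \<in> cross A A' \<union> cross B B'"
    and last: "w \<inter> (cross A A' \<union> cross B B') \<subseteq> {e}"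
  shows "block (insert e g) (w - {e}) (A \<union> B') (B \<union> A')"
proof -
  have "rigid (insert e g) (A \<union> B') (B \<union> A')"
    unfolding rigid_def
  proof (intro allI impI)
    fix c assume c: "proper c (insert e g)"
    then have c': "proper c (g \<union> {e})" by simp
    have r: "rigid g A B" "rigid g A' B'" using 1 2 unfolding block_def by blast+
    obtain s where s: "\<forall>a \<in> A. c a = s" "\<forall>b \<in> B. c b = (\<not> s)"
      using rigid_colours[OF r(1) c'] by (elim exE conjE)
    obtain s' where s': "\<forall>a \<in> A'. c a = s'" "\<forall>b \<in> B'. c b = (\<not> s')"
      using rigid_colours[OF r(2) c'] by (elim exE conjE)
    obtain a b where ab: "e = {a, b}" "a \<in> A \<and> b \<in> A' \<or> a \<in> B \<and> b \<in> B'"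
      using e unfolding cross_def by blast
    then have "c a \<noteq> c b" using c unfolding proper_def by blast
    then have "s' = (\<not> s)" using ab(2) by (auto simp: s s')
    then show "\<exists>s. (\<forall>a \<in> A \<union> B'. c a = s) \<and> (\<forall>b \<in> B \<union> A'. c b = (\<not> s))"
      using s s' by (intro exI[of _ s]) (simp add: ball_Un)
  qed
  moreover have "(w - {e}) \<inter> cross (A \<union> B') (B \<union> A') = {}"
    using 1 2 last cross_commute[of B' B] cross_commute[of B' A']
    unfolding block_def cross_Un by blast
  moreover have "(A \<union> B') \<inter> (B \<union> A') = {}"
    using 1 2 disj unfolding block_def by blast
  ultimately show ?thesis unfolding block_def by blast
qed

text \<open>
  Two rigid blocks have two relative alignments. The first kind of edge contradicts the one in
  which \<open>A\<close> and \<open>A'\<close> get the same colour, the second kind contradicts the other one.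
\<close>
definition linked :: "nat set set \<Rightarrow> nat set \<Rightarrow> nat set \<Rightarrow> nat set \<Rightarrow> nat set \<Rightarrow> bool" where
  "linked w A B A' B' \<longleftrightarrow>
     w \<inter> (cross A A' \<union> cross B B') \<noteq> {} \<and> w \<inter> (cross A B' \<union> cross B A') \<noteq> {}"

lemma linked_commute: "linked w A B A' B' \<Longrightarrow> linked w A' B' A B"
  unfolding linked_def
  by (simp add: cross_commute[of A'] cross_commute[of B'] Un_commute)

lemma linked_mono:
  assumes "linked w A B C D" "w \<subseteq> w'" "A \<subseteq> A'" "B \<subseteq> B'"
  shows "linked w' A' B' C D"
proof -
  have "cross A C \<subseteq> cross A' C" "cross B D \<subseteq> cross B' D"
       "cross A D \<subseteq> cross A' D" "cross B C \<subseteq> cross B' C"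
    by (intro cross_mono assms(3,4) order_refl)+
  then show ?thesis using assms(1,2) unfolding linked_def by blast
qed

lemma linked_not_bipartite:
  assumes 1: "rigid g A B" and 2: "rigid g A' B'" and l: "linked w A B A' B'"
  shows "\<not> proper c (g \<union> w)"
proof
  assume c: "proper c (g \<union> w)"
  obtain s where s: "\<forall>a \<in> A. c a = s" "\<forall>b \<in> B. c b = (\<not> s)"
    using rigid_colours[OF 1 c] by (elim exE conjE)
  obtain s' where s': "\<forall>a \<in> A'. c a = s'" "\<forall>b \<in> B'. c b = (\<not> s')"
    using rigid_colours[OF 2 c] by (elim exE conjE)
  have w: "\<And>a b. {a, b} \<in> w \<Longrightarrow> c a \<noteq> c b"
    using c unfolding proper_def by blast
  have "s \<noteq> s'"
  proof -
    obtain a b where ab: "{a, b} \<in> w" "a \<in> A \<and> b \<in> A' \<or> a \<in> B \<and> b \<in> B'"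
      using l unfolding linked_def cross_def by blast
    show ?thesis using ab(2) w[OF ab(1)] by (auto simp: s s')
  qed
  moreover have "s = s'"
  proof -
    obtain a b where ab: "{a, b} \<in> w" "a \<in> A \<and> b \<in> B' \<or> a \<in> B \<and> b \<in> A'"
      using l unfolding linked_def cross_def by blast
    show ?thesis using ab(2) w[OF ab(1)] by (auto simp: s s')
  qed
  ultimately show False by blast
qed

text \<open>
  If removing \<open>e\<close> destroys the link, then \<open>e\<close> was the last white edge of one of the two
  alignments, which is exactly when answering green merges the blocks. The sides of the second block
  are returned as \<open>A1\<close> and \<open>B1\<close>, exchanged if necessary.
\<close>
lemma linked_merge:
  assumes b: "block g w A B" "block g w A' B'"
    and disj: "(A \<union> B) \<inter> (A' \<union> B') = {}"
    and l: "linked w A B A' B'" and nl: "\<not> linked (w - {e}) A B A' B'"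
  obtains A1 B1 where "block (insert e g) (w - {e}) (A \<union> B1) (B \<union> A1)"
    and "e \<in> cross A A1 \<union> cross B B1"
    and "A1 = A' \<and> B1 = B' \<or> A1 = B' \<and> B1 = A'"
    and "A \<union> B1 \<noteq> {}" and "B \<union> A1 \<noteq> {}"
proof -
  let ?E = "\<lambda>C D. w \<inter> (cross A C \<union> cross B D)"
  have "?E A' B' \<noteq> {}" "?E B' A' \<noteq> {}" "?E A' B' \<subseteq> {e} \<or> ?E B' A' \<subseteq> {e}"
    using l nl unfolding linked_def by blast+
  then obtain A1 B1 where p: "A1 = A' \<and> B1 = B' \<or> A1 = B' \<and> B1 = A'"
    and ne: "?E A1 B1 \<noteq> {}" and last: "?E A1 B1 \<subseteq> {e}"
    by metis
  have e: "e \<in> cross A A1 \<union> cross B B1" using ne last by blast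
  have "block g w A1 B1" using p b(2) block_swap by metis
  moreover have "(A \<union> B) \<inter> (A1 \<union> B1) = {}" using p disj by (metis Un_commute)
  ultimately have "block (insert e g) (w - {e}) (A \<union> B1) (B \<union> A1)"
    using b(1) e last by (intro block_merge)
  moreover have "A \<union> B1 \<noteq> {}" "B \<union> A1 \<noteq> {}"
    using e unfolding cross_def by auto
  ultimately show thesis using e p by (intro that)
qed

section \<open>Secure positions on a finite vertex set\<close>

text \<open>
  The configurations, in the reverse of the order in which a stage runs through them. In
  \<open>three_points\<close>, \<open>u\<close> is the vertex to be absorbed and \<open>x\<close>, \<open>y\<close> are the
  untouched ones; the link with \<open>{x}\<close> says that \<open>x\<close> has white edges to both
  sides of the block. If \<open>x\<close> joins the block, on the side \<open>B\<close>, say, then \<open>two_points\<close>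
  arises: \<open>u\<close> and \<open>y\<close> need white edges only to that side, because together with
  \<open>{p, q}\<close> these close a cycle with one green path of even length. If instead
  two of the three points are joined, they form the centre of \<open>hub\<close>, through which the
  two remaining blocks will be connected.
\<close>
inductive secure :: "nat set \<Rightarrow> nat set set \<Rightarrow> nat set set \<Rightarrow> bool" where
  one_block:
    "\<lbrakk>block g w A B; A \<noteq> {}; B \<noteq> {}; g \<subseteq> cross A B; V = A \<union> B\<rbrakk> \<Longrightarrow> secure V g w"
| two_blocks:
    "\<lbrakk>block g w A B; block g w A' B'; (A \<union> B) \<inter> (A' \<union> B') = {}; linked w A B A' B';
      g \<subseteq> cross A B \<union> cross A' B'; V = A \<union> B \<union> A' \<union> B'\<rbrakk> \<Longrightarrow> secure V g w"
| hub:
    "\<lbrakk>block g w A B; block g w A1 B1; block g w A2 B2;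
      (A \<union> B) \<inter> (A1 \<union> B1) = {}; (A \<union> B) \<inter> (A2 \<union> B2) = {}; (A1 \<union> B1) \<inter> (A2 \<union> B2) = {};
      linked w A B A1 B1; linked w A B A2 B2;
      g \<subseteq> cross A B \<union> cross A1 B1 \<union> cross A2 B2;
      V = A \<union> B \<union> A1 \<union> B1 \<union> A2 \<union> B2\<rbrakk> \<Longrightarrow> secure V g w"
| two_points:
    "\<lbrakk>block g w A B; p \<noteq> q; p \<notin> A \<union> B; q \<notin> A \<union> B;
      w \<inter> cross {p} B \<noteq> {}; w \<inter> cross {q} B \<noteq> {}; {p, q} \<in> w;
      g \<subseteq> cross A B; V = A \<union> B \<union> {p, q}\<rbrakk> \<Longrightarrow> secure V g w"
| three_points:
    "\<lbrakk>block g w A B; distinct [u, x, y]; u \<notin> A \<union> B; x \<notin> A \<union> B; y \<notin> A \<union> B;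
      linked w A B {x} {}; linked w A B {y} {}; {u, x} \<in> w; {u, y} \<in> w; {x, y} \<in> w;
      g \<subseteq> cross A B; V = A \<union> B \<union> {u, x, y}\<rbrakk> \<Longrightarrow> secure V g w"

lemma secure_proper:
  assumes "secure V g w"
  shows "\<exists>c. proper c g"
  using assms
proof cases
  case (one_block A B)
  have "A \<inter> B = {}" using \<open>block g w A B\<close> unfolding block_def by blast
  then show ?thesis using \<open>g \<subseteq> cross A B\<close> by (rule proper_if_subset_cross)
next
  case (two_blocks A B A' B')
  have "(A \<union> A') \<inter> (B \<union> B') = {}" using two_blocks unfolding block_def by blast
  moreover have "g \<subseteq> cross (A \<union> A') (B \<union> B')" using two_blocks unfolding cross_Un by blast
  ultimately show ?thesis by (rule proper_if_subset_cross)
next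
  case (hub A B A1 B1 A2 B2)
  have "(A \<union> A1 \<union> A2) \<inter> (B \<union> B1 \<union> B2) = {}" using hub unfolding block_def by blast
  moreover have "g \<subseteq> cross (A \<union> A1 \<union> A2) (B \<union> B1 \<union> B2)" using hub unfolding cross_Un by blast
  ultimately show ?thesis by (rule proper_if_subset_cross)
next
  case (two_points A B p q)
  have "A \<inter> B = {}" using \<open>block g w A B\<close> unfolding block_def by blast
  then show ?thesis using \<open>g \<subseteq> cross A B\<close> by (rule proper_if_subset_cross)
next
  case (three_points A B u x y)
  have "A \<inter> B = {}" using \<open>block g w A B\<close> unfolding block_def by blast
  then show ?thesis using \<open>g \<subseteq> cross A B\<close> by (rule proper_if_subset_cross)
qed

lemma secure_not_proper:
  assumes "secure V g w" and w: "w \<subseteq> nsets V 2" "w \<noteq> {}"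
  shows "\<not> proper c (g \<union> w)"
  using assms(1)
proof cases
  case (one_block A B)
  show ?thesis
  proof
    assume c: "proper c (g \<union> w)"
    have r: "rigid g A B" using one_block(1) unfolding block_def by blast
    obtain s where s: "\<forall>a \<in> A. c a = s" "\<forall>b \<in> B. c b = (\<not> s)"
      using rigid_colours[OF r c] by (elim exE conjE)
    obtain a b where ab: "{a, b} \<in> w" "{a, b} \<subseteq> V"
      using w by (fastforce simp: nsets_def card_2_iff)
    then have "{a, b} \<notin> cross A B" "{b, a} \<notin> cross A B"
      using one_block(1) unfolding block_def by (auto simp: insert_commute)
    then have "a \<in> A \<and> b \<in> A \<or> a \<in> B \<and> b \<in> B"
      using ab(2) one_block(5) crossI[of a A b B] crossI[of b A a B] by auto
    moreover have "c a \<noteq> c b" using ab c unfolding proper_def by blast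
    ultimately show False by (auto simp: s)
  qed
next
  case (two_blocks A B A' B')
  have "rigid g A B" "rigid g A' B'" using two_blocks(1,2) unfolding block_def by blast+
  then show ?thesis using two_blocks(4) by (rule linked_not_bipartite)
next
  case (hub A B A1 B1 A2 B2)
  have "rigid g A B" "rigid g A1 B1" using hub(1,2) unfolding block_def by blast+
  then show ?thesis using hub(7) by (rule linked_not_bipartite)
next
  case (two_points A B p q)
  show ?thesis
  proof
    assume c: "proper c (g \<union> w)"
    have r: "rigid g A B" using two_points(1) unfolding block_def by blast
    obtain s where s: "\<forall>b \<in> B. c b = (\<not> s)"
      using rigid_colours[OF r c] by (elim exE conjE)
    obtain b b' where b: "{p, b} \<in> w" "{q, b'} \<in> w" "b \<in> B" "b' \<in> B"
      using two_points(5,6) unfolding cross_def by blast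
    have w: "\<And>a b. {a, b} \<in> w \<Longrightarrow> c a \<noteq> c b"
      using c unfolding proper_def by blast
    show False
      using w[OF b(1)] w[OF b(2)] w[OF two_points(7)] bspec[OF s b(3)] bspec[OF s b(4)] by simp
  qed
next
  case (three_points A B u x y)
  have "c u \<noteq> c x" "c u \<noteq> c y" "c x \<noteq> c y" if "proper c (g \<union> w)"
    using that three_points(8-10) unfolding proper_def by blast+
  then show ?thesis by blast
qed

text \<open>
  When the centre merges with one of its partners, the link to the other partner survives, because
  \<open>e\<close> does not touch that partner and links are inherited by larger blocks.
\<close>
lemma hub_step:
  assumes b: "block g w A B" "block g w A1 B1" "block g w A2 B2"
    and disj: "(A \<union> B) \<inter> (A1 \<union> B1) = {}" "(A \<union> B) \<inter> (A2 \<union> B2) = {}"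
      "(A1 \<union> B1) \<inter> (A2 \<union> B2) = {}"
    and l: "linked w A B A1 B1" "linked w A B A2 B2"
    and g: "g \<subseteq> cross A B \<union> cross A1 B1 \<union> cross A2 B2"
    and V: "V = A \<union> B \<union> A1 \<union> B1 \<union> A2 \<union> B2"
    and nl: "\<not> linked (w - {e}) A B A1 B1"
  shows "secure V (insert e g) (w - {e})"
proof -
  obtain A' B' where m: "block (insert e g) (w - {e}) (A \<union> B') (B \<union> A')"
    and e: "e \<in> cross A A' \<union> cross B B'"
    and p: "A' = A1 \<and> B' = B1 \<or> A' = B1 \<and> B' = A1"
    and "A \<union> B' \<noteq> {}" "B \<union> A' \<noteq> {}"
    by (rule linked_merge[OF b(1,2) disj(1) l(1) nl])
  have "e \<inter> (A1 \<union> B1) \<noteq> {}" using e p by (auto dest!: crossD)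
  then have "\<not> e \<subseteq> A \<union> B \<union> (A2 \<union> B2)" using disj by blast
  then have "e \<notin> cross A A2" "e \<notin> cross B B2" "e \<notin> cross A B2" "e \<notin> cross B A2"
    by (auto dest!: crossD)
  then have "linked (w - {e}) A B A2 B2"
    using l(2) unfolding linked_def by blast
  then have l': "linked (w - {e}) (A \<union> B') (B \<union> A') A2 B2"
    by (rule linked_mono) auto
  have m2: "block (insert e g) (w - {e}) A2 B2" using b(3) by (rule block_mono) auto
  have d: "(A \<union> B' \<union> (B \<union> A')) \<inter> (A2 \<union> B2) = {}" using p disj by blast
  have g': "insert e g \<subseteq> cross (A \<union> B') (B \<union> A') \<union> cross A2 B2"
    using g e p cross_commute[of A1 B1] cross_commute[of B B'] cross_commute[of B' A']
    unfolding cross_Un by auto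
  have "V = A \<union> B' \<union> (B \<union> A') \<union> A2 \<union> B2" using V p by blast
  then show ?thesis by (rule secure.two_blocks[OF m m2 d l' g'])
qed

text \<open>
  Here \<open>p\<close> is put on the side opposite to \<open>B\<close>. Then \<open>q\<close> sees both sides of the new
  block, one through \<open>{p, q}\<close> and the other through its white edge to \<open>B\<close>.
\<close>
lemma two_points_step:
  assumes b: "block g w A B" and pq: "p \<noteq> q" "p \<notin> A \<union> B" "q \<notin> A \<union> B"
    and w: "w \<inter> cross {p} B \<noteq> {}" "w \<inter> cross {q} B \<noteq> {}" "{p, q} \<in> w"
    and g: "g \<subseteq> cross A B" and V: "V = A \<union> B \<union> {p, q}"
    and last: "w \<inter> cross {p} B \<subseteq> {e}"
  shows "secure V (insert e g) (w - {e})"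
proof -
  have e: "e \<in> cross {p} B" using w last by blast
  have m: "block (insert e g) (w - {e}) ({p} \<union> A) ({} \<union> B)"
    using block_merge[OF block_singleton block_swap[OF b], of p e] e last pq by auto
  have "{p, q} \<noteq> e" "e \<notin> cross {q} B"
    using e pq unfolding cross_def by (auto simp: doubleton_eq_iff)
  then have "linked (w - {e}) ({p} \<union> A) ({} \<union> B) {q} {}"
    using w cross_commute[of "{q}" B] unfolding linked_def cross_Un by auto
  moreover have "insert e g \<subseteq> cross ({p} \<union> A) ({} \<union> B) \<union> cross {q} {}"
    using e g unfolding cross_Un by auto
  ultimately show ?thesis
    using secure.two_blocks[OF m block_singleton, of q] pq V by (simp add: insert_commute)
qed

text \<open>
  On whichever side \<open>x\<close> joins the block, the edges \<open>{u, x}\<close> and \<open>{y, x}\<close> supply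
  the white edges to that side that \<open>two_points\<close> asks for.
\<close>
lemma three_points_join:
  assumes b: "block g w A B" and d: "distinct [u, x, y]"
    and n: "u \<notin> A \<union> B" "x \<notin> A \<union> B" "y \<notin> A \<union> B"
    and l: "linked w A B {x} {}"
    and w: "{u, x} \<in> w" "{u, y} \<in> w" "{x, y} \<in> w"
    and g: "g \<subseteq> cross A B" and V: "V = A \<union> B \<union> {u, x, y}"
    and nl: "\<not> linked (w - {e}) A B {x} {}"
  shows "secure V (insert e g) (w - {e})"
proof -
  (* The two sides of the block are interchangeable; here x is joined to a vertex of A. *)
  have *: "secure V (insert e g) (w - {e})"
    if b: "block g w A B" and n: "u \<notin> A \<union> B" "x \<notin> A \<union> B" "y \<notin> A \<union> B"
      and g: "g \<subseteq> cross A B" and V: "V = A \<union> B \<union> {u, x, y}"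
      and e: "e \<in> cross A {x}" and last: "w \<inter> cross A {x} \<subseteq> {e}" for A B
  proof -
    have m: "block (insert e g) (w - {e}) A (B \<union> {x})"
      using block_merge[OF b block_singleton, of x e] e last n by auto
    obtain a where a: "a \<in> A" "e = {a, x}" using e unfolding cross_def by blast
    then have "a \<noteq> u" "a \<noteq> y" using n by blast+
    then have ne: "{u, x} \<noteq> e" "{u, y} \<noteq> e" "{y, x} \<noteq> e"
      using a(2) d by (auto simp: doubleton_eq_iff)
    have "{u, x} \<in> (w - {e}) \<inter> cross {u} (B \<union> {x})"
      "{y, x} \<in> (w - {e}) \<inter> cross {y} (B \<union> {x})"
      using ne w(1,3) crossI[of u "{u}" x "B \<union> {x}"] crossI[of y "{y}" x "B \<union> {x}"]
      by (simp_all add: insert_commute[of y x])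
    then have uy: "(w - {e}) \<inter> cross {u} (B \<union> {x}) \<noteq> {}"
      "(w - {e}) \<inter> cross {y} (B \<union> {x}) \<noteq> {}"
      by blast+
    have g': "insert e g \<subseteq> cross A (B \<union> {x})"
      using e g unfolding cross_Un by blast
    have "{u, y} \<in> w - {e}" using w(2) ne(2) by blast
    moreover have "u \<noteq> y" "u \<notin> A \<union> (B \<union> {x})" "y \<notin> A \<union> (B \<union> {x})"
      "V = A \<union> (B \<union> {x}) \<union> {u, y}"
      using n d V by auto
    ultimately show ?thesis
      using secure.two_points[OF m _ _ _ uy _ g'] by blast
  qed
  show ?thesis
  proof (cases "w \<inter> cross A {x} \<subseteq> {e}")
    case True
    then show ?thesis using *[OF b n g V] l unfolding linked_def by auto
  next
    case False
    then have last: "w \<inter> cross B {x} \<subseteq> {e}"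
      using nl unfolding linked_def by auto
    moreover have "e \<in> cross B {x}" using last l unfolding linked_def by auto
    ultimately show ?thesis
      using *[of B A] block_swap[OF b] n g V by (simp add: cross_commute[of B A] Un_commute)
  qed
qed

text \<open>
  Two points that are joined at once form a block with one vertex on each side. Being on both sides, it
  is linked to the third point by the two edges to it, and to the old block as soon as one of the
  two points is.
\<close>
lemma three_points_pair:
  assumes b: "block g w A B" and d: "distinct [p, q, r]"
    and n: "p \<notin> A \<union> B" "q \<notin> A \<union> B" "r \<notin> A \<union> B"
    and l: "linked w A B {p} {}"
    and w: "{p, r} \<in> w" "{q, r} \<in> w"
    and g: "g \<subseteq> cross A B" and V: "V = A \<union> B \<union> {p, q, r}"
  shows "secure V (insert {p, q} g) (w - {{p, q}})"
proof -
  let ?e = "{p, q}"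
  have m: "block (insert ?e g) (w - {?e}) {p} {q}"
    using block_merge[OF block_singleton block_singleton, of p q ?e w g] d by auto
  have "?e \<notin> cross A {p}" "?e \<notin> cross B {p}"
    using n unfolding cross_def by (auto simp: doubleton_eq_iff)
  moreover have "w \<inter> cross A {p} \<noteq> {}" "w \<inter> cross B {p} \<noteq> {}"
    using l unfolding linked_def by simp_all
  ultimately have "(w - {?e}) \<inter> cross A {p} \<noteq> {}" "(w - {?e}) \<inter> cross B {p} \<noteq> {}"
    by blast+
  then have "linked (w - {?e}) A B {p} {}"
    unfolding linked_def by simp
  then have "linked (w - {?e}) {p} {} A B" by (rule linked_commute)
  then have l1: "linked (w - {?e}) {p} {q} A B"
    by (rule linked_mono) auto
  have "?e \<noteq> {p, r}" "?e \<noteq> {q, r}" using d by (auto simp: doubleton_eq_iff)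
  then have l2: "linked (w - {?e}) {p} {q} {r} {}"
    using w unfolding linked_def by auto
  have m1: "block (insert ?e g) (w - {?e}) A B" using b by (rule block_mono) auto
  have "insert ?e g \<subseteq> cross {p} {q} \<union> cross A B \<union> cross {r} {}"
    using g by auto
  then show ?thesis
    using n d V by (intro secure.hub[OF m m1 block_singleton _ _ _ l1 l2]) auto
qed

text \<open>
  The answer is green if the edge is the last white one of some alignment needed for the
  configuration, or if it joins two of the extra points; otherwise it is red.
\<close>
lemma secure_step:
  assumes "secure V g w" and e: "e \<in> w"
  shows "secure V g (w - {e}) \<or> secure V (insert e g) (w - {e})"
proof -
  have bm: "block g w A B \<Longrightarrow> block g (w - {e}) A B" for A B
    by (rule block_mono) auto
  show ?thesis
    using assms(1)
  proof cases
    case (one_block A B)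
    have "secure V g (w - {e})"
      by (rule secure.one_block[OF bm[OF one_block(1)] one_block(2-5)])
    then show ?thesis ..
  next
    case (two_blocks A B A' B')
    show ?thesis
    proof (cases "linked (w - {e}) A B A' B'")
      case True
      have "secure V g (w - {e})"
        by (rule secure.two_blocks[OF bm[OF two_blocks(1)] bm[OF two_blocks(2)]
              two_blocks(3) True two_blocks(5,6)])
      then show ?thesis ..
    next
      case False
      obtain A1 B1 where m: "block (insert e g) (w - {e}) (A \<union> B1) (B \<union> A1)"
        and e: "e \<in> cross A A1 \<union> cross B B1"
        and p: "A1 = A' \<and> B1 = B' \<or> A1 = B' \<and> B1 = A'"
        and ne: "A \<union> B1 \<noteq> {}" "B \<union> A1 \<noteq> {}"
        by (rule linked_merge[OF two_blocks(1-4) False])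
      have g': "insert e g \<subseteq> cross (A \<union> B1) (B \<union> A1)"
        using e p two_blocks(5) cross_commute[of B B1] cross_commute[of A1 B1]
        unfolding cross_Un by auto
      have "V = A \<union> B1 \<union> (B \<union> A1)" using p two_blocks(6) by blast
      then have "secure V (insert e g) (w - {e})" by (rule secure.one_block[OF m ne g'])
      then show ?thesis ..
    qed
  next
    case (hub A B A1 B1 A2 B2)
    show ?thesis
    proof (cases "linked (w - {e}) A B A1 B1")
      case 1: True
      show ?thesis
      proof (cases "linked (w - {e}) A B A2 B2")
        case True
        have "secure V g (w - {e})"
          by (rule secure.hub[OF bm[OF hub(1)] bm[OF hub(2)] bm[OF hub(3)] hub(4-6)
                1 True hub(9,10)])
        then show ?thesis ..
      next
        case False
        have "secure V (insert e g) (w - {e})"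
          by (rule hub_step[OF hub(1,3,2,5,4) _ hub(8,7) _ _ False]) (use hub(6,9,10) in blast)+
        then show ?thesis ..
      qed
    next
      case False
      have "secure V (insert e g) (w - {e})"
        by (rule hub_step[OF hub(1-10) False])
      then show ?thesis ..
    qed
  next
    case (two_points A B p q)
    consider "e = {p, q}" | "w \<inter> cross {p} B \<subseteq> {e}" | "w \<inter> cross {q} B \<subseteq> {e}"
      | "e \<noteq> {p, q}" "(w - {e}) \<inter> cross {p} B \<noteq> {}" "(w - {e}) \<inter> cross {q} B \<noteq> {}"
      by blast
    then show ?thesis
    proof cases
      case 1
      have m: "block (insert e g) (w - {e}) {p} {q}"
        using block_merge[OF block_singleton block_singleton, of p q e w g] two_points(2) 1 by auto
      have "\<not> e \<subseteq> {p} \<union> B" "\<not> e \<subseteq> {q} \<union> B" using 1 two_points(2-4) by auto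
      then have "e \<notin> cross {p} B" "e \<notin> cross {q} B" by (auto dest!: crossD)
      then have l: "linked (w - {e}) {p} {q} A B"
        using two_points(5,6) unfolding linked_def by blast
      have m2: "block (insert e g) (w - {e}) A B" using two_points(1) by (rule block_mono) auto
      have "insert e g \<subseteq> cross {p} {q} \<union> cross A B" using two_points(8) 1 by auto
      then have "secure V (insert e g) (w - {e})"
        using two_points(2-4,9) by (intro secure.two_blocks[OF m m2 _ l]) auto
      then show ?thesis ..
    next
      case 2
      have "secure V (insert e g) (w - {e})"
        by (rule two_points_step[OF two_points 2])
      then show ?thesis ..
    next
      case 3
      have "secure V (insert e g) (w - {e})"
        by (rule two_points_step[OF two_points(1) _ two_points(4,3,6,5) _ two_points(8) _ 3])
          (use two_points(2,7,9) in \<open>auto simp: insert_commute\<close>)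
      then show ?thesis ..
    next
      case 4
      then have "secure V g (w - {e})"
        using secure.two_points[OF bm[OF two_points(1)] two_points(2-4) _ _ _ two_points(8,9)]
          two_points(7) by blast
      then show ?thesis ..
    qed
  next
    case (three_points A B u x y)
    consider "e = {x, y}" | "e = {u, x}" | "e = {u, y}"
      | "\<not> linked (w - {e}) A B {x} {}" | "\<not> linked (w - {e}) A B {y} {}"
      | "e \<noteq> {x, y}" "e \<noteq> {u, x}" "e \<noteq> {u, y}"
        "linked (w - {e}) A B {x} {}" "linked (w - {e}) A B {y} {}"
      by blast
    then show ?thesis
    proof cases
      case 1
      have "secure V (insert {x, y} g) (w - {{x, y}})"
        by (rule three_points_pair[of g w A B x y u])
          (use three_points in \<open>auto simp: insert_commute\<close>)
      then show ?thesis using 1 by blast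
    next
      case 2
      have "secure V (insert {x, u} g) (w - {{x, u}})"
        by (rule three_points_pair[of g w A B x u y])
          (use three_points in \<open>auto simp: insert_commute\<close>)
      then show ?thesis using 2 by (simp add: insert_commute)
    next
      case 3
      have "secure V (insert {y, u} g) (w - {{y, u}})"
        by (rule three_points_pair[of g w A B y u x])
          (use three_points in \<open>auto simp: insert_commute\<close>)
      then show ?thesis using 3 by (simp add: insert_commute)
    next
      case 4
      have "secure V (insert e g) (w - {e})"
        by (rule three_points_join[of g w A B u x y]) (use three_points 4 in auto)
      then show ?thesis ..
    next
      case 5
      have "secure V (insert e g) (w - {e})"
        by (rule three_points_join[of g w A B u y x])
          (use three_points 5 in \<open>auto simp: insert_commute\<close>)
      then show ?thesis ..
    next
      case 6
      then have "secure V g (w - {e})"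
        using secure.three_points[OF bm[OF three_points(1)] three_points(2-5) _ _ _ _ _
            three_points(11,12)] three_points(8-10) by blast
      then show ?thesis ..
    qed
  qed
qed

text \<open>
  On three vertices the triangle is entirely white; it is an instance of \<open>two_points\<close>
  with a block that has only the vertex 0.
\<close>
lemma secure_start:
  "secure {0, 1, 2} {} (nsets {0, 1, 2} 2)"
proof (rule secure.two_points[of _ _ "{}" "{0}" 1 2])
qed (auto simp: block_def rigid_def nsets_def)

text \<open>
  A secure position without white edges can only be a single spanning block, since every other
  configuration has white edges. Both of its sides are nonempty, so an untouched vertex is linked to it.
\<close>
lemma secure_extend:
  assumes s: "secure V g {}" and w: "w \<inter> nsets V 2 = {}"
    and d: "distinct [u, x, y]" "u \<notin> V" "x \<notin> V" "y \<notin> V"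
    and x: "\<And>v. v \<in> insert u V \<Longrightarrow> {v, x} \<in> w"
    and y: "\<And>v. v \<in> insert x (insert u V) \<Longrightarrow> {v, y} \<in> w"
  shows "secure (V \<union> {u, x, y}) g w"
proof -
  obtain A B where b: "block g {} A B" "A \<noteq> {}" "B \<noteq> {}" and g: "g \<subseteq> cross A B"
    and V: "V = A \<union> B"
    using s by cases (auto simp: linked_def)
  have "cross A B \<subseteq> nsets V 2"
    using b V unfolding cross_def block_def nsets_def by (auto simp: card_insert_if)
  then have "block g w A B" using b w unfolding block_def by blast
  moreover have "linked w A B {z} {}" if "\<And>v. v \<in> V \<Longrightarrow> {v, z} \<in> w" for z
    using that b(2,3) V unfolding linked_def cross_def by blast
  ultimately show ?thesis
    using secure.three_points[of g w A B u x y] d x y V g by auto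
qed

section \<open>The strategy of Hider\<close>

definition green :: "turn list \<Rightarrow> nat set set" where
  "green h = {e. (e, Green) \<in> set h}"

definition hider_invariant :: "nat set \<Rightarrow> turn list \<Rightarrow> bool" where
  "hider_invariant V h \<longleftrightarrow> finite V \<and> position h \<and> green h \<subseteq> nsets V 2 \<and>
     white h \<inter> nsets V 2 \<noteq> {} \<and> secure V (green h) (white h \<inter> nsets V 2)"

text \<open>
  The least missing vertex is the one to be absorbed, so that infinitely many stages exhaust the
  natural numbers.
\<close>
definition advances :: "nat set \<Rightarrow> nat set \<Rightarrow> turn list \<Rightarrow> bool" where
  "advances V V' h' \<longleftrightarrow>
     V \<subseteq> V' \<and> white h' \<inter> nsets V 2 = {} \<and> (LEAST v. v \<notin> V) \<in> V'"

lemma position_snoc: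
  assumes "position h" "e \<in> white h"
  shows "position (h @ [(e, a)])"
  using assms unfolding position_def by (auto simp: nth_append less_Suc_eq)

lemma white_snoc: "white (h @ [(e, a)]) = white h - {e}"
  unfolding white_def by auto

lemma hider_invariant_Nil: "hider_invariant {0, 1, 2} []"
proof -
  have "nsets {0, 1, 2} 2 \<subseteq> edges" by (auto simp: nsets_def)
  then have "white [] \<inter> nsets {0, 1, 2} 2 = nsets {0, 1, 2} 2"
    unfolding white_def by auto
  moreover have "{0, 1} \<in> nsets {0, 1, 2::nat} 2" by simp
  then have "nsets {0, 1, 2::nat} 2 \<noteq> {}" by blast
  moreover have "green [] = {}" "position []" unfolding green_def position_def by simp_all
  ultimately show ?thesis
    using secure_start unfolding hider_invariant_def by simp
qed

lemma hider_extend: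
  assumes V: "finite V" and h: "position h" and g: "green h \<subseteq> nsets V 2"
    and w: "white h \<inter> nsets V 2 = {}" and s: "secure V (green h) {}"
  shows "\<exists>V'. hider_invariant V' h \<and> advances V V' h"
proof -
  define u where "u = (LEAST v. v \<notin> V)"
  have "\<exists>v. v \<notin> V" using V by (meson ex_new_if_finite infinite_UNIV_nat)
  then have u: "u \<notin> V" unfolding u_def by (rule LeastI_ex)
  (* T contains all vertices that a played edge touches. *)
  define T where "T = \<Union> (fst ` set h) \<union> insert u V"
  have "e \<in> edges" if "e \<in> fst ` set h" for e
  proof -
    obtain i where "i < length h" "e = fst (h ! i)"
      using \<open>e \<in> fst ` set h\<close> by (metis image_iff in_set_conv_nth)
    then show ?thesis using h unfolding position_def white_def by blast
  qed
  then have "finite T" unfolding T_def using V by (force simp: nsets_def)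
  then obtain x where x: "x \<notin> T" by (meson ex_new_if_finite infinite_UNIV_nat)
  obtain y where y: "y \<notin> insert x T"
    using \<open>finite T\<close> by (meson ex_new_if_finite finite_insert infinite_UNIV_nat)
  define V' where "V' = V \<union> {u, x, y}"
  have fresh: "{v, z} \<in> white h" if "v \<noteq> z" "z \<notin> T" for v z
    using that unfolding white_def T_def by (auto simp: nsets_def)
  have mem: "{v, z} \<in> nsets V' 2" if "v \<noteq> z" "v \<in> V'" "z \<in> V'" for v z
    using that by (auto simp: nsets_def)
  have 1: "{v, x} \<in> white h \<inter> nsets V' 2" if "v \<in> insert u V" for v
    using that x fresh[of v x] mem[of v x] unfolding T_def V'_def by blast
  have 2: "{v, y} \<in> white h \<inter> nsets V' 2" if "v \<in> insert x (insert u V)" for v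
    using that y fresh[of v y] mem[of v y] unfolding T_def V'_def by blast
  have "secure (V \<union> {u, x, y}) (green h) (white h \<inter> nsets V' 2)"
    by (rule secure_extend[OF s])
      (use w x y u 1 2 in \<open>auto simp: T_def\<close>)
  moreover have "green h \<subseteq> nsets V' 2"
    using g unfolding V'_def nsets_def by blast
  ultimately have "hider_invariant V' h"
    using V h 1[of u] unfolding hider_invariant_def V'_def by blast
  moreover have "advances V V' h"
    using w unfolding advances_def V'_def u_def by blast
  ultimately show ?thesis by blast
qed

lemma hider_answer:
  assumes ok: "hider_invariant V h" and e: "e \<in> white h"
  shows "\<exists>a V'. hider_invariant V' (h @ [(e, a)]) \<and> (V' = V \<or> advances V V' (h @ [(e, a)]))"
proof -
  have V: "finite V" and h: "position h" and g: "green h \<subseteq> nsets V 2"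
    and s: "secure V (green h) (white h \<inter> nsets V 2)"
    using ok unfolding hider_invariant_def by auto
  let ?w = "\<lambda>a. white (h @ [(e, a)]) \<inter> nsets V 2"
  have w: "?w a = white h \<inter> nsets V 2 - {e}" for a
    unfolding white_snoc by blast
  have gr: "green (h @ [(e, Red)]) = green h" "green (h @ [(e, Green)]) = insert e (green h)"
    unfolding green_def by auto
  obtain a where g': "green (h @ [(e, a)]) \<subseteq> nsets V 2"
    and s': "secure V (green (h @ [(e, a)])) (?w a)"
  proof (cases "e \<in> nsets V 2")
    case True
    then show thesis
      using that[of Red] that[of Green] secure_step[OF s, of e] e g unfolding w gr by blast
  next
    case False
    then have "?w Red = white h \<inter> nsets V 2" unfolding w by blast
    then show thesis using that[of Red] g s unfolding gr by auto
  qed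
  have h': "position (h @ [(e, a)])" using position_snoc[OF h e] .
  show ?thesis
  proof (cases "?w a = {}")
    case True
    then show ?thesis using hider_extend[OF V h' g'] s' by auto
  next
    case False
    then show ?thesis using V h' g' s' unfolding hider_invariant_def by blast
  qed
qed

text \<open>
  The play and the vertex sets of its stages are built together by dependent choice; the history
  determines the play because its length increases by one with each turn.
\<close>
lemma hider_play:
  assumes \<sigma>: "seeker_strategy \<sigma>"
  obtains p V where "follows p \<sigma>"
    and "\<And>n. hider_invariant (V n) (map p [0..<n])"
    and "\<And>n. V (Suc n) = V n \<or> advances (V n) (V (Suc n)) (map p [0..<Suc n])"
proof -
  define R where "R = (\<lambda>(V, h) (V', h').
    (\<exists>a. h' = h @ [(\<sigma> h, a)]) \<and> (V' = V \<or> advances V V' h'))"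
  have "\<exists>f. \<forall>n. (case f n of (V, h) \<Rightarrow> hider_invariant V h \<and> length h = n) \<and> R (f n) (f (Suc n))"
  proof (rule dependent_nat_choice)
    show "\<exists>s. case s of (V, h) \<Rightarrow> hider_invariant V h \<and> length h = 0"
      using hider_invariant_Nil by auto
  next
    fix s :: "nat set \<times> turn list" and n
    obtain V h where s: "s = (V, h)" by force
    assume "case s of (V, h) \<Rightarrow> hider_invariant V h \<and> length h = n"
    then have ok: "hider_invariant V h" "length h = n" using s by auto
    then have "\<sigma> h \<in> white h" using \<sigma> unfolding seeker_strategy_def hider_invariant_def by blast
    then obtain a V' where "hider_invariant V' (h @ [(\<sigma> h, a)])"
      "V' = V \<or> advances V V' (h @ [(\<sigma> h, a)])"
      using hider_answer ok by blast
    then show "\<exists>s'. (case s' of (V, h) \<Rightarrow> hider_invariant V h \<and> length h = Suc n) \<and> R s s'"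
      using ok s unfolding R_def by (intro exI[of _ "(V', h @ [(\<sigma> h, a)])"]) auto
  qed
  then obtain f where
    f: "\<forall>n. (case f n of (V, h) \<Rightarrow> hider_invariant V h \<and> length h = n) \<and> R (f n) (f (Suc n))" ..
  define V where "V n = fst (f n)" for n
  define h where "h n = snd (f n)" for n
  define p where "p n = last (h (Suc n))" for n
  have ok: "hider_invariant (V n) (h n)" "length (h n) = n" for n
    using f[THEN spec, of n] unfolding V_def h_def by (auto split: prod.splits)
  have step: "\<exists>a. h (Suc n) = h n @ [(\<sigma> (h n), a)]"
    "V (Suc n) = V n \<or> advances (V n) (V (Suc n)) (h (Suc n))" for n
    using f[THEN spec, of n] unfolding R_def V_def h_def by (auto split: prod.splits)
  have hp: "h n = map p [0..<n]" for n
  proof (induction n)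
    case 0
    then show ?case using ok(2)[of 0] by simp
  next
    case (Suc n)
    then show ?case using step(1)[of n] unfolding p_def by auto
  qed
  have "fst (p n) = \<sigma> (map p [0..<n])" for n
    using step(1)[of n] unfolding p_def hp[symmetric] by auto
  then have "follows p \<sigma>" unfolding follows_def by blast
  then show thesis using that ok(1) step(2) unfolding hp by blast
qed

section \<open>The outcome of the play\<close>

lemma UN_prefixes: "(\<Union>n. set (map p [0..<n])) = range p"
  by (simp add: atLeast0LessThan image_UN[symmetric] UN_lessThan_UNIV)

lemma final_white_eq: "final_white p = (\<Inter>n. white (map p [0..<n]))"
proof -
  have "e \<in> final_green p \<union> final_red p \<longleftrightarrow> (\<exists>n. e = fst (p n))" for e
  proof
    assume "\<exists>n. e = fst (p n)"
    then obtain n where n: "p n = (e, snd (p n))" by (metis prod.collapse)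
    show "e \<in> final_green p \<union> final_red p"
      using n unfolding final_green_def final_red_def
      by (cases "snd (p n)") (auto intro: range_eqI[of _ p n])
  qed (auto simp: final_green_def final_red_def, (metis fst_conv)+)
  then have "final_green p \<union> final_red p = range (fst \<circ> p)"
    by (simp add: set_eq_iff image_iff)
  moreover have "(\<Union>n. fst ` set (map p [0..<n])) = range (fst \<circ> p)"
    unfolding image_UN[symmetric] UN_prefixes by (simp add: image_image)
  moreover have "(\<Inter>n. edges - Y n) = edges - (\<Union>n. Y n)" for Y :: "nat \<Rightarrow> nat set set"
    by blast
  ultimately show ?thesis unfolding final_white_def white_def by (simp only:)
qed

lemma final_green_eq: "final_green p = (\<Union>n. green (map p [0..<n]))"
  unfolding final_green_def green_def UN_prefixes[of p, symmetric] by blast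

lemma not_seeker_wins_if_undecided:
  assumes "final_green p \<subseteq> edges" "bipartite (final_green p)"
    "\<not> bipartite (final_green p \<union> final_white p)"
  shows "\<not> seeker_wins bipartite_graphs p"
proof -
  have "final_white p \<subseteq> edges" unfolding final_white_def by blast
  then have "final_green p \<in> final_graphs p" "final_green p \<union> final_white p \<in> final_graphs p"
    using assms(1) unfolding final_graphs_def by auto
  moreover have "final_green p \<in> bipartite_graphs"
    "final_green p \<union> final_white p \<notin> bipartite_graphs"
    using assms unfolding bipartite_graphs_def by auto
  ultimately show ?thesis unfolding seeker_wins_def by blast
qed

text \<open>
  Infinitely many changes of stage would exhaust all vertices, so a given edge would lie inside
  some \<open>V n\<close>; the end of a later stage then leaves it coloured.
\<close>
lemma stage_eventually_constant:
  assumes step: "\<And>n. V (Suc n) = V n \<or> advances (V n) (V (Suc n)) (map p [0..<Suc n])"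
    and white: "final_white p \<noteq> {}"
  obtains N where "\<And>n. n \<ge> N \<Longrightarrow> V n = V N"
proof (rule ccontr)
  assume "\<not> thesis"
  then have ex: "\<exists>n\<ge>N. V n \<noteq> V N" for N using that by blast
  have adv: "\<exists>m\<ge>N. advances (V m) (V (Suc m)) (map p [0..<Suc m])" for N
  proof (rule ccontr)
    assume "\<not> ?thesis"
    then have eq: "m \<ge> N \<Longrightarrow> V (Suc m) = V m" for m using step by blast
    have "V n = V N" if "n \<ge> N" for n
      using that by (induction n rule: dec_induct) (auto simp: eq)
    then show False using ex by blast
  qed
  have mono: "V m \<subseteq> V n" if "m \<le> n" for m n
    using that by (rule lift_Suc_mono_le[rotated]) (use step in \<open>auto simp: advances_def\<close>)
  have covers: "\<exists>n. {..<k} \<subseteq> V n" for k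
  proof (induction k)
    case 0
    then show ?case by auto
  next
    case (Suc k)
    then obtain n where n: "{..<k} \<subseteq> V n" by blast
    obtain m where m: "m \<ge> n" "advances (V m) (V (Suc m)) (map p [0..<Suc m])"
      using adv by blast
    have k: "{..<k} \<subseteq> V m" using n mono[OF m(1)] by blast
    have "k \<in> V (Suc m)"
    proof (cases "k \<in> V m")
      case True
      then show ?thesis using mono[of m "Suc m"] by auto
    next
      case False
      then have "(LEAST v. v \<notin> V m) = k"
        using k by (intro Least_equality) (auto simp: not_less[symmetric])
      then show ?thesis using m(2) unfolding advances_def by simp
    qed
    then have "{..<Suc k} \<subseteq> V (Suc m)"
      using k mono[of m "Suc m"] by (auto simp: lessThan_Suc)
    then show ?case by blast
  qed
  obtain e where e: "e \<in> final_white p" using white by blast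
  then have "e \<in> edges" unfolding final_white_def by blast
  then have "finite e" "card e = 2" by (auto simp: nsets_def)
  then obtain k where "e \<subseteq> {..<k}" by (meson finite_nat_iff_bounded)
  then obtain n where "e \<subseteq> V n" using covers by blast
  moreover obtain m where m: "m \<ge> n" "advances (V m) (V (Suc m)) (map p [0..<Suc m])"
    using adv by blast
  ultimately have "e \<in> nsets (V m) 2"
    using mono[OF m(1)] \<open>finite e\<close> \<open>card e = 2\<close> by (auto simp: nsets_def)
  moreover have "e \<in> white (map p [0..<Suc m])" using e unfolding final_white_eq by blast
  ultimately show False using m(2) unfolding advances_def by blast
qed

text \<open>
  In the last stage the white edges inside \<open>V\<close> decrease within a finite set, so they are
  constant from some turn \<open>M\<close> on. Green edges lie inside \<open>V\<close>, so none appears after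
  turn \<open>M\<close> either, and the secure position at \<open>M\<close> already shows both that the final green
  graph is bipartite and that adding the final white edges makes it not bipartite.
\<close>
lemma hider_wins_play:
  assumes ok: "\<And>n. hider_invariant (V n) (map p [0..<n])"
    and step: "\<And>n. V (Suc n) = V n \<or> advances (V n) (V (Suc n)) (map p [0..<Suc n])"
  shows "\<not> seeker_wins bipartite_graphs p"
proof (cases "final_white p = {}")
  case True
  then show ?thesis unfolding seeker_wins_def by blast
next
  case False
  then obtain N where N: "\<And>n. n \<ge> N \<Longrightarrow> V n = V N"
    using stage_eventually_constant[OF step] by blast
  let ?h = "\<lambda>n. map p [0..<n]"
  let ?w = "\<lambda>n. white (?h n) \<inter> nsets (V N) 2"
  have okN: "hider_invariant (V N) (?h n)" if "n \<ge> N" for n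
    using ok[of n] N[OF that] by simp
  have fin: "finite (?w n)" for n
    using okN[of N] unfolding hider_invariant_def by (simp add: finite_imp_finite_nsets)
  obtain M where M: "M \<ge> N" "\<And>n. n \<ge> N \<Longrightarrow> card (?w M) \<le> card (?w n)"
    using ex_has_least_nat[of "\<lambda>n. n \<ge> N" N "\<lambda>n. card (?w n)"] by auto
  have antimono: "white (?h n) \<subseteq> white (?h m)" if "m \<le> n" for m n
    using that unfolding white_def by auto
  have wM: "?w n = ?w M" if "n \<ge> M" for n
    using card_seteq[OF fin, of "?w n" M] M(2)[of n] M(1) antimono[OF that] that by auto
  have gM: "green (?h n) = green (?h M)" if "n \<ge> M" for n
    using that
  proof (induction n rule: dec_induct)
    case base
    then show ?case ..
  next
    case (step n)
    have "snd (p n) \<noteq> Green"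
    proof
      assume "snd (p n) = Green"
      then have "fst (p n) \<in> green (?h (Suc n))"
        unfolding green_def by (metis (no_types) mem_Collect_eq prod.collapse
            in_set_conv_decomp upt_Suc_append zero_le map_append list.map)
      then have "fst (p n) \<in> nsets (V N) 2"
        using okN[of "Suc n"] step M(1) unfolding hider_invariant_def by auto
      moreover have "fst (p n) \<in> white (?h n)"
        using ok[of "Suc n"] unfolding hider_invariant_def position_def
        by (auto dest!: spec[of _ n] simp: nth_append take_map)
      moreover have "fst (p n) \<notin> white (?h (Suc n))" unfolding white_def by auto
      ultimately show False using wM[of n] wM[of "Suc n"] step by auto
    qed
    then have "green (?h (Suc n)) = green (?h n)" unfolding green_def by (cases "p n") auto
    then show ?case using step by simp
  qed
  have "green (?h n) \<subseteq> green (?h M)" for n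
  proof (cases "n \<le> M")
    case True
    then show ?thesis unfolding green_def by auto
  next
    case False
    then show ?thesis using gM[of n] by simp
  qed
  then have G: "final_green p = green (?h M)" unfolding final_green_eq by blast
  have W: "?w M \<subseteq> final_white p"
    unfolding final_white_eq
  proof (rule INT_greatest)
    fix n
    show "?w M \<subseteq> white (?h n)"
      using wM[of n] antimono[of n M] by (cases "n \<ge> M") auto
  qed
  have okM: "secure (V N) (green (?h M)) (?w M)" "?w M \<noteq> {}" "green (?h M) \<subseteq> edges"
    using okN[OF M(1)] unfolding hider_invariant_def by (auto simp: nsets_def)
  have "final_white p \<subseteq> edges" unfolding final_white_def by blast
  moreover have "\<not> proper c (final_green p \<union> final_white p)" for c
    using secure_not_proper[OF okM(1) _ okM(2), of c] proper_mono[of c] W unfolding G by blast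
  ultimately have "\<not> bipartite (final_green p \<union> final_white p)"
    using okM(3) G bipartite_iff_proper[of "final_green p \<union> final_white p"] by auto
  moreover have "bipartite (final_green p)"
    using secure_proper[OF okM(1)] bipartite_iff_proper okM(3) G by auto
  ultimately show ?thesis using not_seeker_wins_if_undecided okM(3) G by auto
qed

theorem theorem3p5:
  shows "infty_elusive bipartite_graphs"
  unfolding infty_elusive_def winning_strategy_def
  using hider_play hider_wins_play by metis

end
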